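(* Let $n\ge 1$ and $k\ge 0$ be integers. The number of alternating permutations in $\mathfrak{S}_{2n}$ with exactly $n$ fixed points and exactly $k$ excedances is equal to the number of derangements in $\mathfrak{S}_n$ with exactly $k$ excedances.
   Context: $\mathfrak{S}_n$ is the set of permutations of $\{1,\dots,n\}$. A permutation $\pi=\pi_1\pi_2\cdots\pi_m\in\mathfrak{S}_m$ is alternating if $\pi_1>\pi_2<\pi_3>\pi_4<\cdots$. An index $i$ is a fixed point of $\pi$ if $\pi_i=i$ and an excedance of $\pi$ if $\pi_i>i$. A derangement is a permutation with no fixed point. *)

theory Defs
  imports "HOL-Combinatorics.Permutations"
begin

text \<open>
  The set of permutations of \<open>{1, \<dots>, m}\<close> is \<open>{p. p permutes {1..m}}\<close>. The predicate
  \<open>permutes\<close> makes \<open>p :: nat \<Rightarrow> nat\<close> the identity outside \<open>{1..m}\<close>, so distinct such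
  functions are distinct permutations, and the statistics below have to be
  restricted to indices in \<open>{1..m}\<close>.
\<close>

definition alternating_perm :: "nat \<Rightarrow> (nat \<Rightarrow> nat) \<Rightarrow> bool" where
  "alternating_perm m p \<longleftrightarrow> p permutes {1..m} \<and>
     (\<forall>i. 1 \<le> i \<and> i < m \<longrightarrow> (if odd i then p i > p (Suc i) else p i < p (Suc i)))"

definition fixed_points :: "nat \<Rightarrow> (nat \<Rightarrow> nat) \<Rightarrow> nat set" where
  "fixed_points m p = {i \<in> {1..m}. p i = i}"

definition excedances :: "nat \<Rightarrow> (nat \<Rightarrow> nat) \<Rightarrow> nat set" where
  "excedances m p = {i \<in> {1..m}. p i > i}"

definition derangement :: "nat \<Rightarrow> (nat \<Rightarrow> nat) \<Rightarrow> bool" where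
  "derangement m p \<longleftrightarrow> p permutes {1..m} \<and> fixed_points m p = {}"

end

theory Submission
  imports Defs
begin

text \<open>
  Split \<open>{1..2n}\<close> into the descent pairs \<open>{2i-1, 2i}\<close>. Since \<open>\<pi>(2i-1) > \<pi>(2i)\<close>, at most one
  element of each pair is fixed, so \<open>n\<close> fixed points means exactly one per pair. Restricting \<open>\<pi>\<close>
  to the \<open>n\<close> moved points and standardizing gives a derangement \<open>\<sigma>\<close> of \<open>{1..n}\<close> with the same
  number of excedances. The descent condition on the pair forces the moved point to be \<open>2i-1\<close> if
  \<open>\<sigma>(i) > i\<close> and \<open>2i\<close> if \<open>\<sigma>(i) < i\<close>, so \<open>\<pi>\<close> is recovered from \<open>\<sigma>\<close>; conversely, the
  permutation built in this way from a derangement always satisfies the ascent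
  conditions \<open>\<pi>(2i) < \<pi>(2i+1)\<close>.
\<close>

section \<open>Pairs, moved points and the inflation of a permutation\<close>

definition pair_of :: "nat \<Rightarrow> nat" where
  "pair_of j = Suc j div 2"

text \<open>Truncated subtraction sends \<open>i = 0\<close> to 0 in both branches, and
  \<open>pair_of 0 = 0\<close>, so \<open>pair_of_moved\<close> needs no side condition.\<close>

definition moved :: "(nat \<Rightarrow> nat) \<Rightarrow> nat \<Rightarrow> nat" where
  "moved s i = (if s i > i then 2 * i - 1 else 2 * i)"

definition inflate :: "(nat \<Rightarrow> nat) \<Rightarrow> nat \<Rightarrow> nat" where
  "inflate s j = (if moved s (pair_of j) = j then moved s (s (pair_of j)) else j)"

lemma pair_of_moved [simp]: "pair_of (moved s i) = i"
  unfolding pair_of_def moved_def by auto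

lemma inflate_moved [simp]: "inflate s (moved s i) = moved s (s i)"
  by (simp add: inflate_def)

lemma moved_eq_iff [simp]: "moved s i = moved s j \<longleftrightarrow> i = j"
  by (metis pair_of_moved)

text \<open>Distinct pairs are disjoint blocks of consecutive numbers, so the choice inside a pair
  does not affect the order. This is what carries excedances over.\<close>

lemma moved_less_iff: "moved s i < moved s j \<longleftrightarrow> i < j"
  by (cases i j rule: linorder_cases) (auto simp: moved_def)

lemma pair_of_in_iff: "pair_of j \<in> {1..n} \<longleftrightarrow> j \<in> {1..2 * n}"
  unfolding pair_of_def by auto

lemma pair_of_cases:
  obtains "j = 2 * pair_of j - 1" "j > 0" | "j = 2 * pair_of j"
  unfolding pair_of_def by (cases "even j") (auto elim!: evenE oddE)

lemma inflate_permutes: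
  assumes "s permutes {1..n}"
  shows "inflate s permutes {1..2 * n}"
proof -
  \<comment> \<open>The inverse keeps the positions \<open>moved s\<close>. It is not
    \<open>inflate (inv s)\<close>: inverting exchanges values above and below the diagonal, which
    would move the positions.\<close>
  define t where "t j = (if moved s (pair_of j) = j then moved s (inv s (pair_of j)) else j)" for j
  have "inflate s \<circ> t = id" "t \<circ> inflate s = id"
    using permutes_inverses[OF assms] by (auto simp: fun_eq_iff inflate_def t_def)
  then have "bij (inflate s)"
    using o_bij by blast
  moreover have "inflate s j = j" if "j \<notin> {1..2 * n}" for j
  proof -
    have "s (pair_of j) = pair_of j"
      using that permutes_not_in[OF assms] pair_of_in_iff by blast
    then show ?thesis
      by (simp add: inflate_def)
  qed
  ultimately show ?thesis
    by (simp add: permutes_def bij_iff)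
qed

section \<open>Statistics and alternation of an inflated derangement\<close>

lemma derangement_neq:
  assumes "derangement n s" "i \<in> {1..n}"
  shows "s i \<noteq> i"
  using assms by (auto simp: derangement_def fixed_points_def)

lemma inflate_fixed_iff:
  assumes "derangement n s" "j \<in> {1..2 * n}"
  shows "inflate s j = j \<longleftrightarrow> moved s (pair_of j) \<noteq> j"
proof -
  have "s (pair_of j) \<noteq> pair_of j"
    using derangement_neq assms pair_of_in_iff by blast
  then show ?thesis
    by (metis inflate_def moved_eq_iff)
qed

lemma card_fixed_points_inflate:
  assumes "derangement n s"
  shows "card (fixed_points (2 * n) (inflate s)) = n"
proof -
  have "fixed_points (2 * n) (inflate s) = {1..2 * n} - moved s ` {1..n}"
  proof -
    have "j \<in> moved s ` {1..n} \<longleftrightarrow> moved s (pair_of j) = j" if "j \<in> {1..2 * n}" for j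
      using that pair_of_in_iff[of j n] by (metis imageE image_eqI pair_of_moved)
    then show ?thesis
      using inflate_fixed_iff[OF assms] by (auto simp: fixed_points_def)
  qed
  moreover have "moved s ` {1..n} \<subseteq> {1..2 * n}"
    using pair_of_in_iff pair_of_moved by (metis image_subsetI)
  moreover have "card (moved s ` {1..n}) = n"
    by (simp add: card_image inj_on_def)
  ultimately show ?thesis
    by (simp add: card_Diff_subset)
qed

lemma card_excedances_inflate:
  assumes "derangement n s"
  shows "card (excedances (2 * n) (inflate s)) = card (excedances n s)"
proof -
  have "excedances (2 * n) (inflate s) = moved s ` excedances n s"
  proof (intro set_eqI iffI)
    fix j assume j: "j \<in> excedances (2 * n) (inflate s)"
    then have m: "moved s (pair_of j) = j"
      by (auto simp: excedances_def inflate_def split: if_splits)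
    have "moved s (s (pair_of j)) > moved s (pair_of j)"
      using j m by (simp add: excedances_def inflate_def)
    then have "pair_of j \<in> excedances n s"
      using j pair_of_in_iff[of j n] by (auto simp: excedances_def moved_less_iff)
    then show "j \<in> moved s ` excedances n s"
      using m by (metis image_eqI)
  next
    fix j assume "j \<in> moved s ` excedances n s"
    then obtain i where "i \<in> excedances n s" "j = moved s i"
      by blast
    then show "j \<in> excedances (2 * n) (inflate s)"
      using pair_of_in_iff[of j n] by (auto simp: excedances_def moved_less_iff)
  qed
  then show ?thesis
    by (simp add: card_image inj_on_def)
qed

lemma inflate_odd_even:
  assumes "i \<ge> 1"
  shows "inflate s (2 * i - 1) = (if s i > i then moved s (s i) else 2 * i - 1)"
    and "inflate s (2 * i) = (if s i > i then 2 * i else moved s (s i))"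
proof -
  have "pair_of (2 * i - 1) = i" "pair_of (2 * i) = i"
    using assms by (auto simp: pair_of_def)
  then show "inflate s (2 * i - 1) = (if s i > i then moved s (s i) else 2 * i - 1)"
    "inflate s (2 * i) = (if s i > i then 2 * i else moved s (s i))"
    using assms by (auto simp: inflate_def moved_def)
qed

text \<open>Within a pair, the moved point goes up from the left place or down from the right place,
  out of the pair, while its partner stays: a descent. Hence values at odd places are at least the
  place and values at even places at most the place, which gives the ascents between pairs.\<close>

lemma inflate_alternating:
  assumes "derangement n s"
  shows "alternating_perm (2 * n) (inflate s)"
  unfolding alternating_perm_def
proof (intro conjI allI impI)
  show "inflate s permutes {1..2 * n}"
    using assms inflate_permutes by (simp add: derangement_def)
next
  have bounds: "2 * i - 1 \<le> moved s i" "moved s i \<le> 2 * i" for i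
    by (auto simp: moved_def)
  fix j assume j: "1 \<le> j \<and> j < 2 * n"
  show "if odd j then inflate s j > inflate s (Suc j) else inflate s j < inflate s (Suc j)"
  proof (cases "odd j")
    case True
    then obtain i where i: "j = 2 * i + 1"
      by (elim oddE)
    have "s (Suc i) \<noteq> Suc i"
      using derangement_neq[OF assms] i j by auto
    then show ?thesis
      using inflate_odd_even[of "Suc i" s] bounds[of "s (Suc i)"] i by auto
  next
    case False
    then obtain i where i: "j = 2 * i" "i \<ge> 1"
      using j by (auto elim!: evenE)
    have "s i \<noteq> i" "s (Suc i) \<noteq> Suc i"
      using derangement_neq[OF assms] i j by auto
    then show ?thesis
      using inflate_odd_even[of i s] inflate_odd_even[of "Suc i" s]
        bounds[of "s i"] bounds[of "s (Suc i)"] i by auto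
  qed
qed

section \<open>Injectivity and surjectivity of inflation\<close>

lemma inj_on_inflate: "inj_on inflate {s. derangement n s}"
proof (rule inj_onI, simp)
  fix s t assume st: "derangement n s" "derangement n t" "inflate s = inflate t"
  show "s = t"
  proof
    fix i
    show "s i = t i"
    proof (cases "i \<in> {1..n}")
      case False
      then show ?thesis
        using st permutes_not_in unfolding derangement_def by metis
    next
      case True
      then have "moved s i \<in> {1..2 * n}"
        using pair_of_in_iff pair_of_moved by metis
      \<comment> \<open>The common inflation does not fix \<open>moved s i\<close>, so this must
        also be the moved point of pair \<open>i\<close> for \<open>t\<close>.\<close>
      then have "moved t i = moved s i"
        using st inflate_fixed_iff pair_of_moved by metis
      then show ?thesis
        using st(3) inflate_moved pair_of_moved by metis
    qed
  qed
qed

lemma alternating_descent: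
  assumes "alternating_perm (2 * n) p" "i \<in> {1..n}"
  shows "p (2 * i - 1) > p (2 * i)"
  using assms by (auto simp: alternating_perm_def dest: spec[of _ "2 * i - 1"])

lemma pair_of_eqE:
  assumes "pair_of j = pair_of l" "j \<noteq> l"
  obtains "j = 2 * pair_of j - 1" "l = 2 * pair_of j"
  | "j = 2 * pair_of j" "l = 2 * pair_of j - 1"
  using assms by (metis pair_of_cases)

lemma surj_inflate:
  assumes alt: "alternating_perm (2 * n) p" and fix_n: "card (fixed_points (2 * n) p) = n"
  shows "\<exists>s. derangement n s \<and> inflate s = p"
proof -
  define F where "F = fixed_points (2 * n) p"
  define X where "X = {1..2 * n} - F"
  have perm: "p permutes {1..2 * n}"
    using alt by (simp add: alternating_perm_def)
  have inj_F: "inj_on pair_of F"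
  proof (rule inj_onI, rule ccontr)
    fix j l assume jl: "j \<in> F" "l \<in> F" "pair_of j = pair_of l" "j \<noteq> l"
    have "pair_of j \<in> {1..n}"
      using jl(1) pair_of_in_iff by (auto simp: F_def fixed_points_def)
    from alternating_descent[OF alt this] show False
      using pair_of_eqE[OF jl(3,4)] jl(1,2)
      by (smt (verit) F_def diff_le_self fixed_points_def linorder_not_less mem_Collect_eq)
  qed
  have F_sub: "F \<subseteq> {1..2 * n}"
    by (auto simp: F_def fixed_points_def)
  have image_F: "pair_of ` F = {1..n}"
  proof (rule card_subset_eq)
    show "pair_of ` F \<subseteq> {1..n}"
      using F_sub pair_of_in_iff by blast
    show "card (pair_of ` F) = card {1..n}"
      using card_image[OF inj_F] fix_n by (simp add: F_def)
  qed simp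
  have inj_X: "inj_on pair_of X"
  proof (rule inj_onI, rule ccontr)
    fix j l assume jl: "j \<in> X" "l \<in> X" "pair_of j = pair_of l" "j \<noteq> l"
    \<comment> \<open>Every pair contains a fixed point. As a pair has two elements, it would have
      to be \<open>j\<close> or \<open>l\<close>, but neither lies in \<open>F\<close>.\<close>
    then have "pair_of j \<in> pair_of ` F"
      unfolding image_F X_def using pair_of_in_iff by blast
    then obtain m where "m \<in> F" "pair_of m = pair_of j"
      by auto
    then have "m = j \<or> m = l"
      using jl by (metis pair_of_cases)
    then show False
      using jl \<open>m \<in> F\<close> by (auto simp: X_def)
  qed
  have image_X: "pair_of ` X = {1..n}"
  proof (rule card_subset_eq)
    show "pair_of ` X \<subseteq> {1..n}"
      unfolding X_def using pair_of_in_iff by blast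
    have "card X = 2 * n - card F"
      using F_sub unfolding X_def by (simp add: card_Diff_subset finite_subset)
    then show "card (pair_of ` X) = card {1..n}"
      using card_image[OF inj_X] fix_n by (simp add: F_def)
  qed simp
  have p_X: "p j \<in> X" if "j \<in> X" for j
  proof -
    have "j \<in> {1..2 * n}" "p j \<noteq> j"
      using that by (auto simp: X_def F_def fixed_points_def)
    then have "p j \<in> {1..2 * n}" "p (p j) \<noteq> p j"
      using permutes_in_image[OF perm] permutes_inj[OF perm] by (metis, metis injD)
    then show ?thesis
      by (simp add: X_def F_def fixed_points_def)
  qed
  \<comment> \<open>\<open>x i\<close> is the unique moved point of pair \<open>i\<close>;
    \<open>s\<close> below is \<open>p\<close> on \<open>X\<close>, read through this
    labelling.\<close>
  define x where "x = inv_into X pair_of"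
  have x: "x i \<in> X" "pair_of (x i) = i" if "i \<in> {1..n}" for i
    using that inv_into_into[of i pair_of X] f_inv_into_f[of i pair_of X] image_X
    by (simp_all add: x_def)
  have x_pair_of: "x (pair_of j) = j" if "j \<in> X" for j
    using that inj_X by (simp add: x_def)
  define s where "s i = (if i \<in> {1..n} then pair_of (p (x i)) else i)" for i
  have s_perm: "s permutes {1..n}"
  proof (rule inj_imp_permutes)
    show "inj_on s {1..n}"
    proof (rule inj_onI)
      fix i j assume ij: "i \<in> {1..n}" "j \<in> {1..n}" "s i = s j"
      then have "p (x i) = p (x j)"
        using inj_onD[OF inj_X] p_X x by (simp add: s_def)
      then show "i = j"
        using permutes_inj[OF perm] x ij by (metis injD)
    qed
    show "s i \<in> {1..n}" if "i \<in> {1..n}" for i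
      using that p_X x image_X by (auto simp: s_def)
    show "s i = i" if "i \<notin> {1..n}" for i
      using that by (auto simp: s_def)
  qed simp
  \<comment> \<open>The partner of \<open>x i\<close> is fixed, so the descent in the pair compares
    \<open>p (x i)\<close> with the partner itself. This forces \<open>p (x i)\<close> out of the
    pair, upwards if \<open>x i\<close> is on the left and downwards if it is on the right.\<close>
  have s_moved: "moved s i = x i \<and> s i \<noteq> i" if i: "i \<in> {1..n}" for i
  proof -
    have si: "s i = pair_of (p (x i))" "p (x i) \<in> X"
      using i p_X x by (auto simp: s_def)
    have "p (x i) \<noteq> x i"
      using x(1)[OF i] by (auto simp: X_def F_def fixed_points_def)
    then have "s i \<noteq> i"
      using si inj_onD[OF inj_X] x[OF i] by metis
    have other: "p j = j" if "pair_of j = i" "j \<noteq> x i" for j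
    proof -
      have "j \<notin> X" "j \<in> {1..2 * n}"
        using that x_pair_of i pair_of_in_iff by metis+
      then show ?thesis
        by (auto simp: X_def F_def fixed_points_def)
    qed
    note desc = alternating_descent[OF alt i]
    have i1: "i \<ge> 1" "pair_of (2 * i) = i" "pair_of (2 * i - 1) = i"
      using i by (auto simp: pair_of_def)
    show ?thesis
    proof (cases "x i" rule: pair_of_cases)
      case 1
      then have xi: "x i = 2 * i - 1"
        using x(2)[OF i] by simp
      then have "p (2 * i) = 2 * i"
        using other[of "2 * i"] i1 by auto
      then have "p (x i) > 2 * i"
        using desc xi by simp
      then have "s i > i"
        by (auto simp: si(1) pair_of_def)
      then show ?thesis
        using xi by (simp add: moved_def)
    next
      case 2
      then have xi: "x i = 2 * i"
        using x(2)[OF i] by simp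
      then have "p (2 * i - 1) = 2 * i - 1"
        using other[of "2 * i - 1"] i1 by auto
      then have "p (x i) < 2 * i - 1"
        using desc xi by simp
      then have "s i \<le> i"
        by (auto simp: si(1) pair_of_def)
      then show ?thesis
        using xi \<open>s i \<noteq> i\<close> by (simp add: moved_def)
    qed
  qed
  have der: "derangement n s"
    using s_perm s_moved by (auto simp: derangement_def fixed_points_def)
  \<comment> \<open>On \<open>X\<close> both sides agree because \<open>moved s\<close> coincides
    with \<open>x\<close> on the pairs; elsewhere both are the identity.\<close>
  have "inflate s j = p j" for j
  proof (cases "j \<in> {1..2 * n}")
    case False
    then show ?thesis
      using permutes_not_in[OF perm] permutes_not_in[OF inflate_permutes[OF s_perm]] by metis
  next
    case True
    then have i: "pair_of j \<in> {1..n}"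
      using pair_of_in_iff by blast
    show ?thesis
    proof (cases "j \<in> X")
      case True
      have "s (pair_of j) \<in> {1..n}"
        using permutes_in_image[OF s_perm] i by blast
      then have "inflate s j = x (s (pair_of j))"
        using s_moved i x_pair_of[OF True] by (simp add: inflate_def)
      also have "\<dots> = p j"
        using i x_pair_of p_X True by (simp add: s_def)
      finally show ?thesis .
    next
      case False
      then have "moved s (pair_of j) \<noteq> j"
        using s_moved[OF i] x(1)[OF i] by auto
      then show ?thesis
        using False True by (simp add: inflate_def X_def F_def fixed_points_def)
    qed
  qed
  then show ?thesis
    using der by auto
qed

theorem proposition7:
  fixes n k :: nat
  assumes "n \<ge> 1"
  shows "card {p. alternating_perm (2 * n) p \<and> card (fixed_points (2 * n) p) = n
                  \<and> card (excedances (2 * n) p) = k}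
       = card {p. derangement n p \<and> card (excedances n p) = k}"
proof -
  let ?D = "{s. derangement n s \<and> card (excedances n s) = k}"
  \<comment> \<open>Inflation preserves the number of excedances, so the bijection restricts to each
    value of \<open>k\<close>.\<close>
  have "{p. alternating_perm (2 * n) p \<and> card (fixed_points (2 * n) p) = n
          \<and> card (excedances (2 * n) p) = k} = inflate ` ?D"
  proof (intro set_eqI iffI)
    fix p assume "p \<in> {p. alternating_perm (2 * n) p \<and> card (fixed_points (2 * n) p) = n
          \<and> card (excedances (2 * n) p) = k}"
    then show "p \<in> inflate ` ?D"
      using surj_inflate[of n p] card_excedances_inflate by auto
  qed (auto simp: inflate_alternating card_fixed_points_inflate card_excedances_inflate)
  moreover have "inj_on inflate ?D"
    using inj_on_inflate by (rule inj_on_subset) auto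
  ultimately show ?thesis
    by (simp add: card_image)
qed

end
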